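(* Let $n \ge 3$. Under any fair firing schedule, from any initial state, every trajectory of the binary trust-gossip dynamics on $n$ agents reaches an absorbing state in finitely many steps.
   Context: Fix $n \ge 3$ agents. A state is a directed binary matrix $M$ with an entry $M_{ij} \in \{0,1\}$ for each ordered pair of distinct agents $(i,j)$; diagonal entries are undefined. Write $i(j)$ for $M_{ij}$, agent $i$'s opinion of agent $j$; "$i$ trusts $j$" means $i(j)=1$. Firing move: for distinct agents $a$ (speaker), $z$ (listener), $y$ (target) with $z(a)=1$ and $z(y) \ne a(y)$ in the current state, the move sets $z(y) := a(y)$ and changes no other entry. A state is absorbing if no firing move is available in it, i.e. for every triple $(a,z,y)$ of distinct agents, $z(a)=0$ or $z(y)=a(y)$. A firing schedule is a sequence of firing-move choices, one per time step, where each chosen move is available at the corresponding state; the sequence continues as long as the current state is non-absorbing (it can stop only at an absorbing state, where no move is available). The resulting sequence of states is the trajectory. A firing schedule is fair if, whenever a state $M$ occurs infinitely often along the trajectory, every firing move available at $M$ is fired from $M$ infinitely often. *)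

theory Defs
  imports Main "HOL-Library.FuncSet" "HOL-Library.Extended_Nat"
begin

definition pairs :: "nat \<Rightarrow> (nat \<times> nat) set" where
  "pairs n = {(i, j). i < n \<and> j < n \<and> i \<noteq> j}"

text \<open>The agents are \<open>0, \<dots>, n - 1\<close>, and \<open>M (i, j)\<close> is the opinion of \<open>i\<close> about \<open>j\<close>.
  The extensional function space leaves the diagonal (and everything out of range) undefined, so
  equality of states is equality of their off-diagonal entries.\<close>

type_synonym state = "nat \<times> nat \<Rightarrow> nat"

definition states :: "nat \<Rightarrow> state set" where
  "states n = pairs n \<rightarrow>\<^sub>E {0, 1}"

text \<open>A move is a triple (speaker, listener, target).\<close>

type_synonym move = "nat \<times> nat \<times> nat"

definition agent_triples :: "nat \<Rightarrow> move set" where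
  "agent_triples n = {(a, z, y). a < n \<and> z < n \<and> y < n \<and> a \<noteq> z \<and> a \<noteq> y \<and> z \<noteq> y}"

definition available :: "nat \<Rightarrow> state \<Rightarrow> move \<Rightarrow> bool" where
  "available n M = (\<lambda>(a, z, y).
     (a, z, y) \<in> agent_triples n \<and> M (z, a) = 1 \<and> M (z, y) \<noteq> M (a, y))"

definition fire :: "move \<Rightarrow> state \<Rightarrow> state" where
  "fire = (\<lambda>(a, z, y) M. M((z, y) := M (a, y)))"

definition absorbing :: "nat \<Rightarrow> state \<Rightarrow> bool" where
  "absorbing n M \<longleftrightarrow> (\<forall>(a, z, y) \<in> agent_triples n. M (z, a) = 0 \<or> M (z, y) = M (a, y))"

primrec trajectory :: "state \<Rightarrow> (nat \<Rightarrow> move) \<Rightarrow> nat \<Rightarrow> state" where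
  "trajectory M0 \<sigma> 0 = M0"
| "trajectory M0 \<sigma> (Suc t) = fire (\<sigma> t) (trajectory M0 \<sigma> t)"

text \<open>A schedule consists of \<open>N\<close> moves, \<open>N\<close> finite or infinite: the moves are \<open>\<sigma> t\<close> for
  \<open>t < N\<close>, and the states visited are \<open>trajectory M0 \<sigma> t\<close> for \<open>t \<le> N\<close> (\<open>t\<close> finite).
  Values of \<open>\<sigma>\<close> and of the trajectory beyond this range are irrelevant.\<close>

definition firing_schedule :: "nat \<Rightarrow> state \<Rightarrow> enat \<Rightarrow> (nat \<Rightarrow> move) \<Rightarrow> bool" where
  "firing_schedule n M0 N \<sigma> \<longleftrightarrow>
     (\<forall>t. enat t < N \<longrightarrow> available n (trajectory M0 \<sigma> t) (\<sigma> t)) \<and>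
     (\<forall>k. N = enat k \<longrightarrow> absorbing n (trajectory M0 \<sigma> k))"

definition fair :: "nat \<Rightarrow> state \<Rightarrow> enat \<Rightarrow> (nat \<Rightarrow> move) \<Rightarrow> bool" where
  "fair n M0 N \<sigma> \<longleftrightarrow>
     (\<forall>M. infinite {t. enat t \<le> N \<and> trajectory M0 \<sigma> t = M} \<longrightarrow>
        (\<forall>m. available n M m \<longrightarrow>
           infinite {t. enat t < N \<and> trajectory M0 \<sigma> t = M \<and> \<sigma> t = m}))"

end

theory Submission
  imports Defs
begin

text \<open>Read a state as a directed graph, with an edge from \<open>i\<close> to \<open>j\<close> when \<open>i\<close> trusts \<open>j\<close>. The
  heart of the matter is that an absorbing state can be reached from every state; this needs
  only a well-chosen finite sequence of moves, and fairness then does the rest.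

  The sequence has two phases. Copying trust adds the shortcut of a path of length two, so a state
  that is reachable and has the most edges is transitive
  (\<open>reaches_transitive_state\<close>). In a transitive graph every agent \<open>z\<close> belongs to, or
  has a direct edge to each member of, some sink component \<open>D\<close>: a nonempty set of agents who trust
  one another and nobody else. If \<open>z\<close> is not in \<open>D\<close> itself, then by copying distrust
  from a member of \<open>D\<close> it can discard its trust in all agents
  outside \<open>D\<close>. Sink components themselves never change in this phase, so all agents can do it,
  one after the other (\<open>reaches_sink_state\<close>). In the end every agent trusts precisely the
  other agents of one sink component, hence agrees with everyone it trusts, and the state is absorbing
  (\<open>absorbing_sink_state\<close>).

  As there are finitely many states, an infinite trajectory visits one of them infinitely often.
  By fairness, this property passes from a state to each of its successors
  (\<open>recurrent_step\<close>), hence to an absorbing state reachable from it.\<close>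

section \<open>Moves as a transition relation\<close>

definition step :: "nat \<Rightarrow> state \<Rightarrow> state \<Rightarrow> bool" where
  "step n M M' \<longleftrightarrow> (\<exists>m. available n M m \<and> M' = fire m M)"

abbreviation reaches :: "nat \<Rightarrow> state \<Rightarrow> state \<Rightarrow> bool" where
  "reaches n \<equiv> (step n)\<^sup>*\<^sup>*"

lemma finite_pairs: "finite (pairs n)"
  by (rule finite_subset[of _ "{..<n} \<times> {..<n}"]) (auto simp: pairs_def)

lemma finite_states: "finite (states n)"
  unfolding states_def by (rule finite_PiE) (auto simp: finite_pairs)

lemma state_cases:
  assumes "M \<in> states n" "i < n" "j < n" "i \<noteq> j"
  shows "M (i, j) = 0 \<or> M (i, j) = 1"
  using PiE_mem[of M "pairs n" "\<lambda>_. {0, 1}" "(i, j)"] assms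
  by (auto simp: states_def pairs_def)

lemma fire_in_states:
  assumes "M \<in> states n" "available n M m"
  shows "fire m M \<in> states n"
proof -
  obtain a z y where m: "m = (a, z, y)" by (cases m)
  have "(z, y) \<in> pairs n" "M (a, y) \<in> {0, 1}"
    using assms(2) state_cases[OF assms(1), of a y]
    by (auto simp: m available_def agent_triples_def pairs_def)
  then show ?thesis
    using assms(1) by (auto simp: m fire_def states_def PiE_iff extensional_def)
qed

lemma step_in_states: "step n M M' \<Longrightarrow> M \<in> states n \<Longrightarrow> M' \<in> states n"
  by (auto simp: step_def fire_in_states)

lemma reaches_in_states: "reaches n M M' \<Longrightarrow> M \<in> states n \<Longrightarrow> M' \<in> states n"
  by (induction rule: rtranclp_induct) (auto simp: step_in_states)

lemma step_copy:
  assumes "(a, z, y) \<in> agent_triples n" "M (z, a) = 1" "M (z, y) \<noteq> M (a, y)"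
  shows "step n M (M((z, y) := M (a, y)))"
  using assms unfolding step_def
  by (intro exI[of _ "(a, z, y)"]) (simp add: available_def fire_def)

section \<open>Reaching a transitive state\<close>

definition trust_edges :: "nat \<Rightarrow> state \<Rightarrow> (nat \<times> nat) set" where
  "trust_edges n M = {p \<in> pairs n. M p = 1}"

lemma finite_trust_edges: "finite (trust_edges n M)"
  by (simp add: trust_edges_def finite_pairs)

definition trust_transitive :: "nat \<Rightarrow> state \<Rightarrow> bool" where
  "trust_transitive n M \<longleftrightarrow>
     (\<forall>(a, z, y) \<in> agent_triples n. M (z, a) = 1 \<longrightarrow> M (a, y) = 1 \<longrightarrow> M (z, y) = 1)"

text \<open>A failure of transitivity is an available move that adds an edge, so it is impossible in a
  reachable state with the largest number of edges.\<close>

lemma reaches_transitive_state: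
  assumes M: "M \<in> states n"
  obtains T where "reaches n M T" "T \<in> states n" "trust_transitive n T"
proof -
  have "\<forall>T. reaches n M T \<longrightarrow> card (trust_edges n T) < Suc (card (pairs n))"
    by (auto simp: less_Suc_eq_le trust_edges_def finite_pairs intro!: card_mono)
  then obtain T where T: "reaches n M T"
    and max: "\<And>T'. reaches n M T' \<Longrightarrow> card (trust_edges n T') \<le> card (trust_edges n T)"
    using ex_has_greatest_nat[of "reaches n M" M "\<lambda>T. card (trust_edges n T)"] by blast
  have Ts: "T \<in> states n" using reaches_in_states[OF T M] .
  have "T (z, y) = 1"
    if azy: "(a, z, y) \<in> agent_triples n" and za: "T (z, a) = 1" and ay: "T (a, y) = 1"
    for a z y
  proof (rule ccontr)
    assume zy: "T (z, y) \<noteq> 1"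
    let ?T' = "T((z, y) := 1)"
    have "step n T ?T'" using step_copy[OF azy, of T] za zy ay by simp
    then have "card (trust_edges n ?T') \<le> card (trust_edges n T)"
      using max T by (meson rtranclp.rtrancl_into_rtrancl)
    moreover have "trust_edges n ?T' = insert (z, y) (trust_edges n T)"
      using azy by (auto simp: trust_edges_def agent_triples_def pairs_def)
    moreover have "(z, y) \<notin> trust_edges n T" using zy by (simp add: trust_edges_def)
    ultimately show False by (simp add: finite_trust_edges)
  qed
  then have "trust_transitive n T" by (auto simp: trust_transitive_def)
  with T Ts that show ?thesis by blast
qed

section \<open>Sink components of a transitive state\<close>

text \<open>The reflexive closure of trust: with \<open>z\<close> itself included, the set attached to a member of
  a clique does not depend on the member.\<close>

definition trust_cone :: "nat \<Rightarrow> state \<Rightarrow> nat \<Rightarrow> nat set" where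
  "trust_cone n T z = {y. y < n \<and> (y = z \<or> T (z, y) = 1)}"

lemma trust_cone_mono:
  assumes "trust_transitive n T" "z < n" "a \<in> trust_cone n T z"
  shows "trust_cone n T a \<subseteq> trust_cone n T z"
  using assms by (fastforce simp: trust_transitive_def trust_cone_def agent_triples_def)

text \<open>The assignment \<open>D\<close> picks for each agent one sink component inside its cone.\<close>

definition sink_choice :: "nat \<Rightarrow> state \<Rightarrow> (nat \<Rightarrow> nat set) \<Rightarrow> bool" where
  "sink_choice n T D \<longleftrightarrow> (\<forall>z<n. D z \<noteq> {} \<and> D z \<subseteq> trust_cone n T z \<and>
     (\<forall>a \<in> D z. trust_cone n T a = D z \<and> D a = D z))"

text \<open>A smallest cone inside the cone of \<open>z\<close> is a sink component: the cones of its members lie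
  inside it, and cannot be smaller.\<close>

lemma sink_choice_exists:
  assumes T: "trust_transitive n T"
  obtains D where "sink_choice n T D"
proof -
  let ?R = "trust_cone n T"
  have "\<exists>r. r \<in> ?R z \<and> (\<forall>a \<in> ?R z. card (?R r) \<le> card (?R a))" if "z < n" for z
    using ex_has_least_nat[of "\<lambda>a. a \<in> ?R z" z "\<lambda>a. card (?R a)"] that
    by (auto simp: trust_cone_def)
  then obtain r where r: "\<And>z. z < n \<Longrightarrow> r z \<in> ?R z"
    and min: "\<And>z a. z < n \<Longrightarrow> a \<in> ?R z \<Longrightarrow> card (?R (r z)) \<le> card (?R a)"
    by metis
  have lt: "a < n" if "a \<in> ?R z" for a z using that by (simp add: trust_cone_def)
  have fin: "finite (?R z)" for z by (simp add: trust_cone_def)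
  have cone: "?R a = ?R (r z)" if z: "z < n" and a: "a \<in> ?R (r z)" for z a
  proof (rule card_seteq[OF fin])
    show "?R a \<subseteq> ?R (r z)" using trust_cone_mono[OF T lt[OF r[OF z]] a] .
    show "card (?R (r z)) \<le> card (?R a)"
      using min[OF z] a trust_cone_mono[OF T z r[OF z]] by blast
  qed
  have "sink_choice n T (\<lambda>z. ?R (r z))"
    unfolding sink_choice_def
  proof (intro allI impI conjI ballI)
    fix z assume z: "z < n"
    show "?R (r z) \<noteq> {}" using lt[OF r[OF z]] by (auto simp: trust_cone_def)
    show "?R (r z) \<subseteq> ?R z" using trust_cone_mono[OF T z r[OF z]] .
    fix a assume a: "a \<in> ?R (r z)"
    show "?R a = ?R (r z)" using cone[OF z a] .
    have "r a \<in> ?R (r z)" using r[OF lt[OF a]] cone[OF z a] by simp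
    then show "?R (r a) = ?R (r z)" using cone[OF z] by blast
  qed
  then show ?thesis by (rule that)
qed

section \<open>Discarding trust outside the sink components\<close>

text \<open>Both agents of an edge from \<open>z\<close> to \<open>a\<close> trust exactly the other agents of
  \<open>D z = D a\<close>, so they have nothing to copy from each other.\<close>

lemma absorbing_sink_state:
  assumes D: "sink_choice n T D" and M: "M \<in> states n"
    and eq: "\<And>z y. z < n \<Longrightarrow> y < n \<Longrightarrow> z \<noteq> y \<Longrightarrow> M (z, y) = 1 \<longleftrightarrow> y \<in> D z"
  shows "absorbing n M"
proof -
  have "M (z, y) = M (a, y)" if azy: "(a, z, y) \<in> agent_triples n" and za: "M (z, a) \<noteq> 0" for a z y
  proof -
    have azy': "a < n" "z < n" "y < n" "a \<noteq> z" "a \<noteq> y" "z \<noteq> y"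
      using azy by (auto simp: agent_triples_def)
    then have "M (z, a) = 1" using za state_cases[OF M, of z a] by auto
    then have "a \<in> D z" using eq azy' by auto
    then have "D a = D z" using D azy'(2) unfolding sink_choice_def by blast
    then have "M (z, y) = 1 \<longleftrightarrow> M (a, y) = 1" using eq azy' by auto
    then show ?thesis
      using state_cases[OF M, of z y] state_cases[OF M, of a y] azy' by auto
  qed
  then show ?thesis unfolding absorbing_def by blast
qed

text \<open>The target is the state in which every \<open>z\<close> trusts exactly the other
  agents of \<open>D z\<close>. Among the states
  reachable from \<open>T\<close> whose edges lie between those of the target and those of \<open>T\<close>, one
  with the fewest edges is the target. For if \<open>z\<close> still trusts some \<open>y\<close> outside \<open>D z\<close>, then
  a member \<open>a\<close> of \<open>D z\<close> never trusted \<open>y\<close>, while \<open>z\<close> still trusts \<open>a\<close>; so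
  \<open>z\<close> can copy the distrust of \<open>y\<close> from \<open>a\<close>.\<close>

lemma reaches_sink_state:
  assumes T: "T \<in> states n" and D: "sink_choice n T D"
  obtains M where "reaches n T M"
    "\<And>z y. z < n \<Longrightarrow> y < n \<Longrightarrow> z \<noteq> y \<Longrightarrow> M (z, y) = 1 \<longleftrightarrow> y \<in> D z"
proof -
  define above where "above M \<longleftrightarrow> (\<forall>z<n. \<forall>y<n. z \<noteq> y \<longrightarrow> y \<in> D z \<longrightarrow> M (z, y) = 1)" for M :: state
  define P where "P M \<longleftrightarrow> reaches n T M \<and> above M \<and> trust_edges n M \<subseteq> trust_edges n T" for M
  have D_sub: "D z \<subseteq> trust_cone n T z" if "z < n" for z
    using D that unfolding sink_choice_def by blast
  have cone_eq: "trust_cone n T a = D z" if "z < n" "a \<in> D z" for a z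
    using D that unfolding sink_choice_def by blast
  have "above T" using D_sub by (force simp: above_def trust_cone_def)
  then have "P T" by (simp add: P_def)
  then obtain M where M: "P M"
    and min: "\<And>M'. P M' \<Longrightarrow> card (trust_edges n M) \<le> card (trust_edges n M')"
    using ex_has_least_nat[of P T "\<lambda>M. card (trust_edges n M)"] by blast
  have Ms: "M \<in> states n" using M reaches_in_states T by (auto simp: P_def)
  have "y \<in> D z" if z: "z < n" and y: "y < n" and zy: "z \<noteq> y" and trusts: "M (z, y) = 1" for z y
  proof (rule ccontr)
    assume out: "y \<notin> D z"
    obtain a where a: "a \<in> D z" using D z unfolding sink_choice_def by blast
    have cone: "trust_cone n T a = D z" using cone_eq[OF z a] .
    have an: "a < n" using D_sub[OF z] a by (auto simp: trust_cone_def)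
    have below: "T (i, j) = 1" if "M (i, j) = 1" "i < n" "j < n" "i \<noteq> j" for i j
      using M that by (auto simp: P_def trust_edges_def pairs_def)
    have "y \<in> trust_cone n T z" using below trusts z y zy by (simp add: trust_cone_def)
    then have az: "a \<noteq> z" using out cone by blast
    have ay: "a \<noteq> y" using a out by auto
    have "M (z, a) = 1" using M z an a az by (auto simp: P_def above_def)
    moreover have "M (a, y) \<noteq> 1"
      using below[of a y] out an y ay by (auto simp flip: cone simp: trust_cone_def)
    then have May: "M (a, y) = 0" using state_cases[OF Ms an y ay] by blast
    moreover have "(a, z, y) \<in> agent_triples n"
      using an z y az ay zy by (simp add: agent_triples_def)
    ultimately have step: "step n M (M((z, y) := 0))"
      using step_copy[of a z y n M] trusts by simp
    let ?M' = "M((z, y) := 0)"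
    have edges: "trust_edges n ?M' = trust_edges n M - {(z, y)}"
      by (auto simp: trust_edges_def)
    have "above ?M'" using M out by (auto simp: P_def above_def)
    then have "P ?M'"
      using M step edges by (auto simp: P_def intro: rtranclp.rtrancl_into_rtrancl)
    moreover have "(z, y) \<in> trust_edges n M"
      using trusts z y zy by (simp add: trust_edges_def pairs_def)
    then have "card (trust_edges n ?M') < card (trust_edges n M)"
      unfolding edges by (rule card_Diff1_less[OF finite_trust_edges])
    ultimately show False using min[of ?M'] by simp
  qed
  then have "M (z, y) = 1 \<longleftrightarrow> y \<in> D z" if "z < n" "y < n" "z \<noteq> y" for z y
    using M that by (auto simp: P_def above_def)
  with M that show ?thesis by (auto simp: P_def)
qed

lemma reaches_absorbing_state:
  assumes "M \<in> states n"
  obtains A where "reaches n M A" "absorbing n A"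
proof -
  obtain T where T: "reaches n M T" "T \<in> states n" "trust_transitive n T"
    using reaches_transitive_state[OF assms] .
  obtain D where D: "sink_choice n T D" using sink_choice_exists[OF T(3)] .
  obtain A where A: "reaches n T A"
    "\<And>z y. z < n \<Longrightarrow> y < n \<Longrightarrow> z \<noteq> y \<Longrightarrow> A (z, y) = 1 \<longleftrightarrow> y \<in> D z"
    using reaches_sink_state[OF T(2) D] by blast
  have "absorbing n A"
    using absorbing_sink_state[OF D reaches_in_states[OF A(1) T(2)]] A(2) by blast
  with T(1) A(1) that show ?thesis by (meson rtranclp_trans)
qed

section \<open>Fair infinite trajectories\<close>

definition recurrent :: "state \<Rightarrow> (nat \<Rightarrow> move) \<Rightarrow> state \<Rightarrow> bool" where
  "recurrent M0 \<sigma> M \<longleftrightarrow> infinite {t. trajectory M0 \<sigma> t = M}"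

lemma recurrent_step:
  assumes fair: "fair n M0 \<infinity> \<sigma>" and M: "recurrent M0 \<sigma> M" and step: "step n M M'"
  shows "recurrent M0 \<sigma> M'"
proof -
  obtain m where m: "available n M m" "M' = fire m M" using step by (auto simp: step_def)
  have "infinite {t. trajectory M0 \<sigma> t = M \<and> \<sigma> t = m}"
    using fair M m(1) by (cases m) (simp add: fair_def recurrent_def)
  then have "infinite (Suc ` {t. trajectory M0 \<sigma> t = M \<and> \<sigma> t = m})"
    by (simp add: finite_image_iff)
  moreover have "Suc ` {t. trajectory M0 \<sigma> t = M \<and> \<sigma> t = m} \<subseteq> {t. trajectory M0 \<sigma> t = M'}"
    using m(2) by auto
  ultimately show ?thesis unfolding recurrent_def using finite_subset by blast
qed

lemma recurrent_reaches:
  assumes "fair n M0 \<infinity> \<sigma>"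
  shows "reaches n M M' \<Longrightarrow> recurrent M0 \<sigma> M \<Longrightarrow> recurrent M0 \<sigma> M'"
  by (induction rule: rtranclp_induct) (auto intro: recurrent_step[OF assms])

lemma trajectory_in_states:
  assumes "M0 \<in> states n" "firing_schedule n M0 \<infinity> \<sigma>"
  shows "trajectory M0 \<sigma> t \<in> states n"
  using assms by (induction t) (auto simp: firing_schedule_def fire_in_states)

lemma recurrent_state_exists:
  assumes "M0 \<in> states n" "firing_schedule n M0 \<infinity> \<sigma>"
  obtains M where "M \<in> states n" "recurrent M0 \<sigma> M"
proof -
  have sub: "range (trajectory M0 \<sigma>) \<subseteq> states n" using trajectory_in_states[OF assms] by blast
  then obtain s where "infinite {t. trajectory M0 \<sigma> t = trajectory M0 \<sigma> s}"
    using pigeonhole_infinite[of UNIV "trajectory M0 \<sigma>"] finite_subset[OF sub finite_states]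
    by auto
  with sub that show ?thesis by (auto simp: recurrent_def)
qed

theorem theorem2:
  fixes n :: nat and M0 :: state and N :: enat and \<sigma> :: "nat \<Rightarrow> move"
  assumes "n \<ge> 3"
    and "M0 \<in> states n"
    and "firing_schedule n M0 N \<sigma>"
    and "fair n M0 N \<sigma>"
  shows "\<exists>t. enat t \<le> N \<and> absorbing n (trajectory M0 \<sigma> t)"
proof (cases N)
  case (enat k)
  \<comment> \<open>A finite schedule can only have stopped at an absorbing state.\<close>
  then show ?thesis using assms(3) by (auto simp: firing_schedule_def)
next
  case infinity
  obtain M where M: "M \<in> states n" "recurrent M0 \<sigma> M"
    using recurrent_state_exists assms(2,3) infinity by blast
  obtain A where A: "reaches n M A" "absorbing n A"
    using reaches_absorbing_state[OF M(1)] .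
  have "recurrent M0 \<sigma> A"
    using recurrent_reaches A(1) M(2) assms(4) infinity by blast
  then have "{t. trajectory M0 \<sigma> t = A} \<noteq> {}" unfolding recurrent_def by (metis finite.emptyI)
  with A(2) infinity show ?thesis by auto
qed

end
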